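(* Let $K$ be the infinite king's grid. Then $\mathrm{RED{:}OLD}\%(K) \le \frac{1}{3}$, where $\mathrm{RED{:}OLD}\%(K)$ denotes the lowest density of a redundant open-locating-dominating (RED:OLD) set on $K$.
   Context: The infinite king's grid $K$ is the infinite graph with vertex set $\mathbb{Z}^2$ in which two distinct vertices $(a,b)$ and $(c,d)$ are adjacent if and only if $\max(|a-c|,|b-d|)=1$ (so $K$ is 8-regular). $N(v)$ denotes the open neighborhood of $v$ (the set of vertices adjacent to $v$). A set $S \subseteq V(G)$ of vertices of a graph $G$ is an open-locating-dominating (OLD) set if, for every vertex $v$, $N(v)\cap S \neq \varnothing$, and for all distinct vertices $u,v$, $N(u)\cap S \ne N(v)\cap S$. A set $S$ is a redundant open-locating-dominating (RED:OLD) set if for every $D \subseteq S$ with $|D|\le 1$, the set $S - D$ is an OLD set (in particular $S$ itself is an OLD set). The density of $S\subseteq V(K)$ is the ratio of the size of $S$ to that of $V(K)$, understood as $\limsup_{n\to\infty} \frac{|S\cap Q_n|}{|Q_n|}$ with $Q_n=\{-n,\dots,n\}^2$. $\mathrm{RED{:}OLD}\%(K)$ is the infimum of the densities of all RED:OLD sets on $K$. *)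

theory Defs
  imports "HOL-Analysis.Analysis"
begin

text \<open>A graph is given by its vertex set \<open>V\<close> and its adjacency relation \<open>E\<close>;
  the vertex set may be infinite.\<close>

definition open_nbhd :: "'a set \<Rightarrow> ('a \<Rightarrow> 'a \<Rightarrow> bool) \<Rightarrow> 'a \<Rightarrow> 'a set" where
  "open_nbhd V E v = {u \<in> V. E v u}"

definition OLD_set :: "'a set \<Rightarrow> ('a \<Rightarrow> 'a \<Rightarrow> bool) \<Rightarrow> 'a set \<Rightarrow> bool" where
  "OLD_set V E S \<longleftrightarrow> S \<subseteq> V \<and>
     (\<forall>v\<in>V. open_nbhd V E v \<inter> S \<noteq> {}) \<and>
     (\<forall>u\<in>V. \<forall>v\<in>V. u \<noteq> v \<longrightarrow> open_nbhd V E u \<inter> S \<noteq> open_nbhd V E v \<inter> S)"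

text \<open>Finiteness of \<open>D\<close> is required explicitly because \<^const>\<open>card\<close> is \<open>0\<close> on infinite sets.\<close>

definition RED_OLD_set :: "'a set \<Rightarrow> ('a \<Rightarrow> 'a \<Rightarrow> bool) \<Rightarrow> 'a set \<Rightarrow> bool" where
  "RED_OLD_set V E S \<longleftrightarrow> S \<subseteq> V \<and>
     (\<forall>D. D \<subseteq> S \<and> finite D \<and> card D \<le> 1 \<longrightarrow> OLD_set V E (S - D))"

definition king_verts :: "(int \<times> int) set" where
  "king_verts = UNIV"

definition king_adj :: "int \<times> int \<Rightarrow> int \<times> int \<Rightarrow> bool" where
  "king_adj p q \<longleftrightarrow> max \<bar>fst p - fst q\<bar> \<bar>snd p - snd q\<bar> = 1"

definition grid_box :: "nat \<Rightarrow> (int \<times> int) set" where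
  "grid_box n = {- int n..int n} \<times> {- int n..int n}"

text \<open>The values are extended reals, so that \<^const>\<open>limsup\<close> and the infimum below are taken
  in a complete lattice and the infimum of the empty set is \<open>\<infinity>\<close>.\<close>

definition grid_density :: "(int \<times> int) set \<Rightarrow> ereal" where
  "grid_density S =
     limsup (\<lambda>n. ereal (real (card (S \<inter> grid_box n)) / real (card (grid_box n))))"

definition king_RED_OLD_density :: ereal where
  "king_RED_OLD_density = (INF S \<in> {S. RED_OLD_set king_verts king_adj S}. grid_density S)"

end

theory Submission
  imports Defs "HOL-Real_Asymp.Real_Asymp"
begin

text \<open>Every third antidiagonal, \<open>{(x, y). 3 dvd x + y}\<close>, is a RED:OLD set: a vertex on a chosen
  antidiagonal sees its two neighbours along it, and any other vertex sees two consecutive vertices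
  of the adjacent chosen antidiagonal and one vertex of the next one. These neighbourhood traces
  have at least two elements and none of them contains another one, so any two of them differ in
  at least two elements.\<close>

text \<open>Domination and separation pass from a set to any larger subset of \<open>V\<close>, and
  every admissible \<open>D\<close>, even the empty one, lies in some singleton \<open>{d}\<close>.
  Testing the removal of single points therefore suffices, whether or not they belong to
  \<open>S\<close>.\<close>

lemma RED_OLD_setI:
  assumes "S \<subseteq> V"
    and dom: "\<And>v d. v \<in> V \<Longrightarrow> open_nbhd V E v \<inter> (S - {d}) \<noteq> {}"
    and sep: "\<And>u v d. u \<in> V \<Longrightarrow> v \<in> V \<Longrightarrow> u \<noteq> v \<Longrightarrow>
      open_nbhd V E u \<inter> (S - {d}) \<noteq> open_nbhd V E v \<inter> (S - {d})"
  shows "RED_OLD_set V E S"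
  unfolding RED_OLD_set_def
proof (intro conjI allI impI)
  fix D assume D: "D \<subseteq> S \<and> finite D \<and> card D \<le> 1"
  then obtain d where d: "D \<subseteq> {d}"
    by (metis card_le_Suc0_iff_eq One_nat_def singletonI subsetI)
  then have eq: "S - {d} = (S - D) - {d}" by blast
  have "open_nbhd V E v \<inter> (S - D) \<noteq> {}" if "v \<in> V" for v
    using dom[OF that, of d] eq by blast
  moreover have "open_nbhd V E u \<inter> (S - D) \<noteq> open_nbhd V E v \<inter> (S - D)"
    if "u \<in> V" "v \<in> V" "u \<noteq> v" for u v
    using sep[OF that, of d] eq by blast
  ultimately show "OLD_set V E (S - D)"
    using \<open>S \<subseteq> V\<close> unfolding OLD_set_def by blast
qed (fact \<open>S \<subseteq> V\<close>)

definition third_antidiagonals :: "(int \<times> int) set" where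
  "third_antidiagonals = {(x, y). 3 dvd x + y}"

lemma king_nbhd:
  "open_nbhd king_verts king_adj (x, y) =
    {(x+1, y), (x-1, y), (x, y+1), (x, y-1), (x+1, y+1), (x-1, y-1), (x+1, y-1), (x-1, y+1)}"
proof -
  have "max \<bar>x - p\<bar> \<bar>y - q\<bar> = 1 \<longleftrightarrow> (p, q) \<in>
      {(x+1, y), (x-1, y), (x, y+1), (x, y-1), (x+1, y+1), (x-1, y-1), (x+1, y-1), (x-1, y+1)}"
    for p q
    unfolding insert_iff prod.inject empty_iff by smt
  then show ?thesis
    by (simp only: set_eq_iff split_paired_All open_nbhd_def king_verts_def king_adj_def
        mem_Collect_eq UNIV_I fst_conv snd_conv simp_thms)
qed

text \<open>A king move changes \<open>x + y\<close> by at most 2. Residue 0 therefore needs a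
  change of 0, residue 1 a change of -1 or 2, and residue 2 a change of 1 or -2.\<close>

lemma king_nbhd_third_antidiagonals:
  "open_nbhd king_verts king_adj (x, y) \<inter> third_antidiagonals =
    (if (x + y) mod 3 = 0 then {(x+1, y-1), (x-1, y+1)}
     else if (x + y) mod 3 = 1 then {(x-1, y), (x, y-1), (x+1, y+1)}
     else {(x+1, y), (x, y+1), (x-1, y-1)})"
proof -
  have *: "3 dvd x + 1 + y \<longleftrightarrow> (x + y) mod 3 = 2" "3 dvd x - 1 + y \<longleftrightarrow> (x + y) mod 3 = 1"
    "3 dvd x + (y + 1) \<longleftrightarrow> (x + y) mod 3 = 2" "3 dvd x + (y - 1) \<longleftrightarrow> (x + y) mod 3 = 1"
    "3 dvd x + 1 + (y + 1) \<longleftrightarrow> (x + y) mod 3 = 1" "3 dvd x - 1 + (y - 1) \<longleftrightarrow> (x + y) mod 3 = 2"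
    "3 dvd x + 1 + (y - 1) \<longleftrightarrow> (x + y) mod 3 = 0" "3 dvd x - 1 + (y + 1) \<longleftrightarrow> (x + y) mod 3 = 0"
    by presburger+
  consider "(x + y) mod 3 = 0" | "(x + y) mod 3 = 1" | "(x + y) mod 3 = 2"
    by atomize_elim presburger
  then show ?thesis
    unfolding king_nbhd third_antidiagonals_def Int_insert_left mem_Collect_eq prod.case *
    by cases simp_all
qed

text \<open>The centroid of every trace is its own vertex, so equal traces have equal vertices. By
  cardinality, a proper inclusion could only put a pair inside a triple, but the two points of a
  pair differ by \<open>(2, -2)\<close> up to sign and no two points of a triple do.\<close>

lemma king_nbhd_third_antidiagonals_antichain:
  assumes "open_nbhd king_verts king_adj u \<inter> third_antidiagonals \<subseteq>
    open_nbhd king_verts king_adj v \<inter> third_antidiagonals"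
  shows "u = v"
proof -
  obtain a b x y where "u = (a, b)" "v = (x, y)"
    by (cases u; cases v)
  with assms show ?thesis
    by (simp only: king_nbhd_third_antidiagonals insert_subset insert_iff empty_iff prod.inject
        split: if_splits) smt+
qed

lemma RED_OLD_set_third_antidiagonals: "RED_OLD_set king_verts king_adj third_antidiagonals"
proof (rule RED_OLD_setI)
  show "third_antidiagonals \<subseteq> king_verts" by (simp add: king_verts_def)
next
  fix v d :: "int \<times> int"
  show "open_nbhd king_verts king_adj v \<inter> (third_antidiagonals - {d}) \<noteq> {}"
    by (cases v; cases d) (auto simp: Int_Diff[symmetric] king_nbhd_third_antidiagonals)
next
  fix u v d :: "int \<times> int"
  assume "u \<noteq> v"
  let ?T = "\<lambda>z. open_nbhd king_verts king_adj z \<inter> third_antidiagonals"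
  \<comment> \<open>These two points are distinct, so at least one survives the deletion of
    \<open>d\<close> and still tells \<open>u\<close> from \<open>v\<close>.\<close>
  obtain p q where "p \<in> ?T u - ?T v" "q \<in> ?T v - ?T u"
    using king_nbhd_third_antidiagonals_antichain[of u v]
      king_nbhd_third_antidiagonals_antichain[of v u] \<open>u \<noteq> v\<close> by blast
  then show "open_nbhd king_verts king_adj u \<inter> (third_antidiagonals - {d}) \<noteq>
      open_nbhd king_verts king_adj v \<inter> (third_antidiagonals - {d})"
    by blast
qed

lemma card_symmetric_int_interval: "card {- int n..int n} = 2 * n + 1"
  by simp

text \<open>Dividing by 3 maps the multiples of 3 injectively into an interval. What matters is that
  the excess over \<open>2 * n + 1\<close> is bounded, so that it vanishes in the density.\<close>

lemma card_int_interval_dvd: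
  fixes n :: nat and x :: int
  shows "3 * card {y \<in> {- int n..int n}. 3 dvd x + y} \<le> 2 * n + 5"
proof -
  let ?Y = "{y \<in> {- int n..int n}. 3 dvd x + y}"
  let ?I = "{(x - int n) div 3..(x + int n) div 3}"
  have "inj_on (\<lambda>y. (x + y) div 3) ?Y"
    by (rule inj_onI) (auto elim!: dvdE)
  moreover have "(\<lambda>y. (x + y) div 3) ` ?Y \<subseteq> ?I"
    by (auto intro!: zdiv_mono1)
  ultimately have "card ?Y \<le> card ?I"
    by (intro card_inj_on_le) auto
  \<comment> \<open>Rounding down makes the endpoints of \<open>?I\<close> differ by at most
    \<open>(2 * n + 2) / 3\<close>; counting both endpoints adds 1, hence 3 after scaling.\<close>
  also have "3 * int (card ?I) \<le> 2 * int n + 5"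
    by simp
  finally show ?thesis by linarith
qed

lemma card_third_antidiagonals_grid_box:
  "3 * card (third_antidiagonals \<inter> grid_box n) \<le> (2 * n + 1) * (2 * n + 5)"
proof -
  \<comment> \<open>Slicing the box into columns reduces the count to one dimension.\<close>
  have "third_antidiagonals \<inter> grid_box n =
      (SIGMA x:{- int n..int n}. {y \<in> {- int n..int n}. 3 dvd x + y})"
    by (auto simp: third_antidiagonals_def grid_box_def)
  then have "3 * card (third_antidiagonals \<inter> grid_box n) =
      (\<Sum>x\<in>{- int n..int n}. 3 * card {y \<in> {- int n..int n}. 3 dvd x + y})"
    by (simp only: card_SigmaI finite_Collect_conjI finite_atLeastAtMost_int Collect_mem_eq
        ball_triv sum_distrib_left simp_thms)
  also have "\<dots> \<le> (\<Sum>x\<in>{- int n..int n}. 2 * n + 5)"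
    by (intro sum_mono card_int_interval_dvd)
  also have "\<dots> = (2 * n + 1) * (2 * n + 5)"
    by (simp only: sum_constant card_symmetric_int_interval of_nat_id)
  finally show ?thesis .
qed

lemma grid_density_third_antidiagonals: "grid_density third_antidiagonals \<le> ereal (1 / 3)"
proof -
  have ratio: "real (card (third_antidiagonals \<inter> grid_box n)) / real (card (grid_box n))
      \<le> (2 * real n + 5) / (3 * (2 * real n + 1))" for n
  proof -
    have box: "real (card (grid_box n)) = (2 * real n + 1) * (2 * real n + 1)"
      by (simp only: grid_box_def card_cartesian_product card_symmetric_int_interval
          of_nat_mult of_nat_add of_nat_numeral of_nat_1)
    have cancel: "a * b / 3 / (a * a) = b / (3 * a)" if "a \<noteq> 0" for a b :: real
      using that by simp
    have "real (3 * card (third_antidiagonals \<inter> grid_box n)) \<le> real ((2 * n + 1) * (2 * n + 5))"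
      using card_third_antidiagonals_grid_box of_nat_le_iff by blast
    then have "real (card (third_antidiagonals \<inter> grid_box n))
        \<le> (2 * real n + 1) * (2 * real n + 5) / 3"
      by (simp add: algebra_simps)
    then have "real (card (third_antidiagonals \<inter> grid_box n)) / real (card (grid_box n))
        \<le> (2 * real n + 1) * (2 * real n + 5) / 3 / real (card (grid_box n))"
      by (rule divide_right_mono) simp
    also have "\<dots> = (2 * real n + 5) / (3 * (2 * real n + 1))"
      unfolding box by (rule cancel) linarith
    finally show ?thesis .
  qed
  have "(\<lambda>n. (2 * real n + 5) / (3 * (2 * real n + 1))) \<longlonglongrightarrow> 1 / 3"
    by real_asymp
  \<comment> \<open>The upper bound converges, so its \<open>limsup\<close> is its limit;
    monotonicity of \<open>limsup\<close> then transfers the bound to the density.\<close>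
  then have "limsup (\<lambda>n. ereal ((2 * real n + 5) / (3 * (2 * real n + 1)))) = ereal (1 / 3)"
    by (intro lim_imp_Limsup) auto
  then show ?thesis
    unfolding grid_density_def
    by (metis (mono_tags, lifting) Limsup_mono always_eventually ereal_less_eq(3) ratio)
qed

theorem mainTheorem2:
  shows "king_RED_OLD_density \<le> ereal (1 / 3)"
  unfolding king_RED_OLD_density_def
  using RED_OLD_set_third_antidiagonals grid_density_third_antidiagonals
  by (auto intro: INF_lower2)

end
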